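(* Let a point-free relation algebra satisfy the axiom of choice (every per has an index). Then a per $P$ is maximal with respect to the thins ordering $\preceq$ on pers if and only if $\mathbb{I}\cap \top\circ P\circ\top\subseteq P$ (where $\mathbb{I}$ and $\top$ have the same type as $P$).
   Context: A point-free relation algebra consists of the following. There is a non-empty set of basic types; each element (relation) $X$ has a type $A\sim B$ for basic types $A,B$. Monoid structure: for $X$ of type $A\sim B$ and $Y$ of type $B\sim C$ there is a composition $X\circ Y$ of type $A\sim C$; composition is associative, and for each basic type $A$ there is an identity $\mathbb{I}$ of type $A\sim A$ which is a unit of composition. Lattice structure: the relations of each type $A\sim B$ form a (finitely) distributive lattice ordered by $\subseteq$ with join $\cup$, meet $\cap$, least element $\bot$ and greatest element $\top$ (types of $\mathbb{I},\bot,\top$ are deduced from context). Factors: there are operators $\setminus$ and $/$ with $(Y\subseteq X\setminus Z)\equiv (X\circ Y\subseteq Z)\equiv (X\subseteq Z/Y)$. Converse: for each $X$ of type $A\sim B$ there is $X^{\smile}$ of type $B\sim A$, with $X^{\smile}\subseteq Y\equiv X\subseteq Y^{\smile}$, $\mathbb{I}^{\smile}=\mathbb{I}$, $(X\circ Y)^{\smile}=Y^{\smile}\circ X^{\smile}$. Modularity law: $X\circ Y\cap Z\subseteq X\circ(Y\cap X^{\smile}\circ Z)$. Complements and the cone rule ($\top\circ X\circ\top=\top\equiv X\neq\bot$) are not assumed. Composition binds tighter than $\cap$. A per is a relation $P$ (of some type $A\sim A$) with $P=P^{\smile}$ and $P\circ P\subseteq P$. For a per $P$, $\mathrm{dom}(P)=\mathbb{I}\cap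 P$ is its (left and right) domain. Thins: for pers $P,Q$ of the same type, $P\preceq Q$ iff $P=\mathrm{dom}(P)\circ Q\circ \mathrm{dom}(P)$ and $Q=Q\circ \mathrm{dom}(P)\circ Q$. This relation is a partial ordering on pers. A per $P$ is maximal iff for all pers $Q$, $P\preceq Q$ implies $P=Q$. An index of a per $P$ is a relation $J$ with (a) $J\subseteq \mathrm{dom}(P)$, (b) $J\circ P\circ J=J$, (c) $P\circ J\circ P=P$. The axiom of choice is the statement: every per has an index. *)

theory Defs
  imports Main
begin

text \<open>
  A point-free relation algebra is a many-sorted structure; \<^term>\<open>Rel R A B\<close> is the set of
  relations of type \<open>A \<sim> B\<close>. The operations are total HOL functions that are constrained only
  on well-typed arguments. The identity and the least and greatest relations carry their type
  explicitly.
\<close>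

record ('t, 'r) relation_algebra =
  basic_types :: "'t set"
  Rel :: "'t \<Rightarrow> 't \<Rightarrow> 'r set"
  compo :: "'r \<Rightarrow> 'r \<Rightarrow> 'r"  (infixl \<open>\<odot>\<index>\<close> 75)
  ident :: "'t \<Rightarrow> 'r"  (\<open>\<one>\<index>\<close>)
  incl :: "'r \<Rightarrow> 'r \<Rightarrow> bool"  (infix \<open>\<sqsubseteq>\<index>\<close> 50)
  join :: "'r \<Rightarrow> 'r \<Rightarrow> 'r"  (infixl \<open>\<squnion>\<index>\<close> 65)
  meet :: "'r \<Rightarrow> 'r \<Rightarrow> 'r"  (infixl \<open>\<sqinter>\<index>\<close> 70)
  least :: "'t \<Rightarrow> 't \<Rightarrow> 'r"  (\<open>\<bottom>\<index>\<close>)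
  greatest :: "'t \<Rightarrow> 't \<Rightarrow> 'r"  (\<open>\<top>\<index>\<close>)
  under :: "'r \<Rightarrow> 'r \<Rightarrow> 'r"
  over :: "'r \<Rightarrow> 'r \<Rightarrow> 'r"
  converse :: "'r \<Rightarrow> 'r"  (\<open>_\<smile>\<index>\<close> [1000] 999)

text \<open>
  The factor \<open>X \ Z\<close> is \<^term>\<open>under R X Z\<close>, and \<open>Z / Y\<close> is \<^term>\<open>over R Z Y\<close>.
\<close>

locale point_free_relation_algebra =
  fixes R :: "('t, 'r, 'm) relation_algebra_scheme" (structure)
  assumes types_nonempty: "basic_types R \<noteq> {}"
    and type_unique:
      "\<lbrakk>A \<in> basic_types R; B \<in> basic_types R; C \<in> basic_types R; D \<in> basic_types R;
        X \<in> Rel R A B; X \<in> Rel R C D\<rbrakk> \<Longrightarrow> A = C \<and> B = D"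
    and comp_type:
      "\<lbrakk>A \<in> basic_types R; B \<in> basic_types R; C \<in> basic_types R;
        X \<in> Rel R A B; Y \<in> Rel R B C\<rbrakk> \<Longrightarrow> X \<odot> Y \<in> Rel R A C"
    and ident_type: "A \<in> basic_types R \<Longrightarrow> \<one> A \<in> Rel R A A"
    and join_type:
      "\<lbrakk>A \<in> basic_types R; B \<in> basic_types R; X \<in> Rel R A B; Y \<in> Rel R A B\<rbrakk>
        \<Longrightarrow> X \<squnion> Y \<in> Rel R A B"
    and meet_type:
      "\<lbrakk>A \<in> basic_types R; B \<in> basic_types R; X \<in> Rel R A B; Y \<in> Rel R A B\<rbrakk>
        \<Longrightarrow> X \<sqinter> Y \<in> Rel R A B"
    and least_type: "\<lbrakk>A \<in> basic_types R; B \<in> basic_types R\<rbrakk> \<Longrightarrow> \<bottom> A B \<in> Rel R A B"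
    and greatest_type: "\<lbrakk>A \<in> basic_types R; B \<in> basic_types R\<rbrakk> \<Longrightarrow> \<top> A B \<in> Rel R A B"
    and under_type:
      "\<lbrakk>A \<in> basic_types R; B \<in> basic_types R; C \<in> basic_types R;
        X \<in> Rel R A B; Z \<in> Rel R A C\<rbrakk> \<Longrightarrow> under R X Z \<in> Rel R B C"
    and over_type:
      "\<lbrakk>A \<in> basic_types R; B \<in> basic_types R; C \<in> basic_types R;
        Z \<in> Rel R A C; Y \<in> Rel R B C\<rbrakk> \<Longrightarrow> over R Z Y \<in> Rel R A B"
    and converse_type:
      "\<lbrakk>A \<in> basic_types R; B \<in> basic_types R; X \<in> Rel R A B\<rbrakk> \<Longrightarrow> X\<smile> \<in> Rel R B A"
    and comp_assoc:
      "\<lbrakk>A \<in> basic_types R; B \<in> basic_types R; C \<in> basic_types R; D \<in> basic_types R;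
        X \<in> Rel R A B; Y \<in> Rel R B C; Z \<in> Rel R C D\<rbrakk>
        \<Longrightarrow> (X \<odot> Y) \<odot> Z = X \<odot> (Y \<odot> Z)"
    and ident_left:
      "\<lbrakk>A \<in> basic_types R; B \<in> basic_types R; X \<in> Rel R A B\<rbrakk> \<Longrightarrow> \<one> A \<odot> X = X"
    and ident_right:
      "\<lbrakk>A \<in> basic_types R; B \<in> basic_types R; X \<in> Rel R A B\<rbrakk> \<Longrightarrow> X \<odot> \<one> B = X"
    and incl_refl:
      "\<lbrakk>A \<in> basic_types R; B \<in> basic_types R; X \<in> Rel R A B\<rbrakk> \<Longrightarrow> X \<sqsubseteq> X"
    and incl_trans:
      "\<lbrakk>A \<in> basic_types R; B \<in> basic_types R;
        X \<in> Rel R A B; Y \<in> Rel R A B; Z \<in> Rel R A B; X \<sqsubseteq> Y; Y \<sqsubseteq> Z\<rbrakk> \<Longrightarrow> X \<sqsubseteq> Z"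
    and incl_antisym:
      "\<lbrakk>A \<in> basic_types R; B \<in> basic_types R;
        X \<in> Rel R A B; Y \<in> Rel R A B; X \<sqsubseteq> Y; Y \<sqsubseteq> X\<rbrakk> \<Longrightarrow> X = Y"
    and join_lub:
      "\<lbrakk>A \<in> basic_types R; B \<in> basic_types R;
        X \<in> Rel R A B; Y \<in> Rel R A B; Z \<in> Rel R A B\<rbrakk>
        \<Longrightarrow> X \<squnion> Y \<sqsubseteq> Z \<longleftrightarrow> X \<sqsubseteq> Z \<and> Y \<sqsubseteq> Z"
    and meet_glb:
      "\<lbrakk>A \<in> basic_types R; B \<in> basic_types R;
        X \<in> Rel R A B; Y \<in> Rel R A B; Z \<in> Rel R A B\<rbrakk>
        \<Longrightarrow> Z \<sqsubseteq> X \<sqinter> Y \<longleftrightarrow> Z \<sqsubseteq> X \<and> Z \<sqsubseteq> Y"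
    and least_incl:
      "\<lbrakk>A \<in> basic_types R; B \<in> basic_types R; X \<in> Rel R A B\<rbrakk> \<Longrightarrow> \<bottom> A B \<sqsubseteq> X"
    and incl_greatest:
      "\<lbrakk>A \<in> basic_types R; B \<in> basic_types R; X \<in> Rel R A B\<rbrakk> \<Longrightarrow> X \<sqsubseteq> \<top> A B"
    and meet_join_distrib:
      "\<lbrakk>A \<in> basic_types R; B \<in> basic_types R;
        X \<in> Rel R A B; Y \<in> Rel R A B; Z \<in> Rel R A B\<rbrakk>
        \<Longrightarrow> X \<sqinter> (Y \<squnion> Z) = (X \<sqinter> Y) \<squnion> (X \<sqinter> Z)"
    and under_galois:
      "\<lbrakk>A \<in> basic_types R; B \<in> basic_types R; C \<in> basic_types R;
        X \<in> Rel R A B; Y \<in> Rel R B C; Z \<in> Rel R A C\<rbrakk>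
        \<Longrightarrow> Y \<sqsubseteq> under R X Z \<longleftrightarrow> X \<odot> Y \<sqsubseteq> Z"
    and over_galois:
      "\<lbrakk>A \<in> basic_types R; B \<in> basic_types R; C \<in> basic_types R;
        X \<in> Rel R A B; Y \<in> Rel R B C; Z \<in> Rel R A C\<rbrakk>
        \<Longrightarrow> X \<odot> Y \<sqsubseteq> Z \<longleftrightarrow> X \<sqsubseteq> over R Z Y"
    and converse_galois:
      "\<lbrakk>A \<in> basic_types R; B \<in> basic_types R; X \<in> Rel R A B; Y \<in> Rel R B A\<rbrakk>
        \<Longrightarrow> X\<smile> \<sqsubseteq> Y \<longleftrightarrow> X \<sqsubseteq> Y\<smile>"
    and converse_ident: "A \<in> basic_types R \<Longrightarrow> (\<one> A)\<smile> = \<one> A"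
    and converse_comp:
      "\<lbrakk>A \<in> basic_types R; B \<in> basic_types R; C \<in> basic_types R;
        X \<in> Rel R A B; Y \<in> Rel R B C\<rbrakk> \<Longrightarrow> (X \<odot> Y)\<smile> = Y\<smile> \<odot> X\<smile>"
    and modularity:
      "\<lbrakk>A \<in> basic_types R; B \<in> basic_types R; C \<in> basic_types R;
        X \<in> Rel R A B; Y \<in> Rel R B C; Z \<in> Rel R A C\<rbrakk>
        \<Longrightarrow> X \<odot> Y \<sqinter> Z \<sqsubseteq> X \<odot> (Y \<sqinter> X\<smile> \<odot> Z)"

definition is_per :: "('t, 'r, 'm) relation_algebra_scheme \<Rightarrow> 't \<Rightarrow> 'r \<Rightarrow> bool" where
  "is_per R A P \<longleftrightarrow>
     A \<in> basic_types R \<and> P \<in> Rel R A A \<and> P = P\<smile>\<^bsub>R\<^esub> \<and> P \<odot>\<^bsub>R\<^esub> P \<sqsubseteq>\<^bsub>R\<^esub> P"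

definition per_dom :: "('t, 'r, 'm) relation_algebra_scheme \<Rightarrow> 't \<Rightarrow> 'r \<Rightarrow> 'r" where
  "per_dom R A P = \<one>\<^bsub>R\<^esub> A \<sqinter>\<^bsub>R\<^esub> P"

definition thins :: "('t, 'r, 'm) relation_algebra_scheme \<Rightarrow> 't \<Rightarrow> 'r \<Rightarrow> 'r \<Rightarrow> bool" where
  "thins R A P Q \<longleftrightarrow>
     is_per R A P \<and> is_per R A Q \<and>
     P = per_dom R A P \<odot>\<^bsub>R\<^esub> Q \<odot>\<^bsub>R\<^esub> per_dom R A P \<and>
     Q = Q \<odot>\<^bsub>R\<^esub> per_dom R A P \<odot>\<^bsub>R\<^esub> Q"

definition maximal_per :: "('t, 'r, 'm) relation_algebra_scheme \<Rightarrow> 't \<Rightarrow> 'r \<Rightarrow> bool" where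
  "maximal_per R A P \<longleftrightarrow>
     is_per R A P \<and> (\<forall>Q. is_per R A Q \<longrightarrow> thins R A P Q \<longrightarrow> P = Q)"

definition is_index :: "('t, 'r, 'm) relation_algebra_scheme \<Rightarrow> 't \<Rightarrow> 'r \<Rightarrow> 'r \<Rightarrow> bool" where
  "is_index R A P J \<longleftrightarrow>
     J \<in> Rel R A A \<and>
     J \<sqsubseteq>\<^bsub>R\<^esub> per_dom R A P \<and>
     J \<odot>\<^bsub>R\<^esub> P \<odot>\<^bsub>R\<^esub> J = J \<and>
     P \<odot>\<^bsub>R\<^esub> J \<odot>\<^bsub>R\<^esub> P = P"

definition axiom_of_choice :: "('t, 'r, 'm) relation_algebra_scheme \<Rightarrow> bool" where
  "axiom_of_choice R \<longleftrightarrow> (\<forall>A P. is_per R A P \<longrightarrow> (\<exists>J. is_index R A P J))"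

end

theory Submission
  imports Defs
begin

text \<open>
  If \<open>P \<preceq> Q\<close> and \<open>D = dom P\<close>, then \<open>dom Q \<subseteq> Q \<circ> D \<circ> Q\<close> lies in \<open>\<top> \<circ> P \<circ> \<top>\<close>; so the inclusion
  forces \<open>dom Q \<subseteq> D\<close> and hence \<open>Q = P\<close>.

  For the converse there are no complements, so the points outside \<open>D\<close> must be obtained from
  choice. Let \<open>J\<close> be an index of the per \<open>\<one> \<union> D \<circ> \<top> \<circ> D\<close>, which collapses \<open>D\<close> to one class.
  Then \<open>J \<union> D = \<one>\<close>, and \<open>K = J \<circ> D\<close> is a point of \<open>D\<close> that exists wherever \<open>D\<close> is non-empty.
  Hence \<open>B = D \<union> J \<circ> \<top> \<circ> K\<close>, which fixes \<open>D\<close> and sends \<open>J\<close> to \<open>K\<close>, is single-valued, and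
  \<open>P \<preceq> B \<circ> P \<circ> B\<smile>\<close>. Maximality makes the two equal, and the right side contains
  \<open>\<one> \<inter> \<top> \<circ> P \<circ> \<top>\<close>.
\<close>

context point_free_relation_algebra
begin

section \<open>Order, lattice and composition at one fixed type\<close>

context
  fixes A :: 't
  assumes A: "A \<in> basic_types R"
begin

text \<open>Carrying the typing inside the order makes transitivity free of side conditions.\<close>

definition below :: "'r \<Rightarrow> 'r \<Rightarrow> bool"  (infix \<open>\<unlhd>\<close> 50) where
  "X \<unlhd> Y \<longleftrightarrow> X \<in> Rel R A A \<and> Y \<in> Rel R A A \<and> X \<sqsubseteq> Y"

lemma types [simp, intro]:
  "\<one> A \<in> Rel R A A" "\<top> A A \<in> Rel R A A"
  "X \<in> Rel R A A \<Longrightarrow> Y \<in> Rel R A A \<Longrightarrow> X \<odot> Y \<in> Rel R A A"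
  "X \<in> Rel R A A \<Longrightarrow> Y \<in> Rel R A A \<Longrightarrow> X \<squnion> Y \<in> Rel R A A"
  "X \<in> Rel R A A \<Longrightarrow> Y \<in> Rel R A A \<Longrightarrow> X \<sqinter> Y \<in> Rel R A A"
  "X \<in> Rel R A A \<Longrightarrow> X\<smile> \<in> Rel R A A"
  using A by (auto intro: ident_type greatest_type comp_type join_type meet_type converse_type)

lemma below_types: "X \<unlhd> Y \<Longrightarrow> X \<in> Rel R A A" "X \<unlhd> Y \<Longrightarrow> Y \<in> Rel R A A"
  by (auto simp: below_def)

lemma assoc:
  "X \<in> Rel R A A \<Longrightarrow> Y \<in> Rel R A A \<Longrightarrow> Z \<in> Rel R A A \<Longrightarrow> X \<odot> Y \<odot> Z = X \<odot> (Y \<odot> Z)"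
  using comp_assoc A by blast

lemma unit [simp]: "X \<in> Rel R A A \<Longrightarrow> \<one> A \<odot> X = X" "X \<in> Rel R A A \<Longrightarrow> X \<odot> \<one> A = X"
  using ident_left ident_right A by blast+

lemma below_refl [intro]: "X \<in> Rel R A A \<Longrightarrow> X \<unlhd> X"
  using incl_refl A by (auto simp: below_def)

lemma below_trans [trans]: "X \<unlhd> Y \<Longrightarrow> Y \<unlhd> Z \<Longrightarrow> X \<unlhd> Z"
  unfolding below_def using incl_trans[OF A A] by blast

lemma below_antisym: "X \<unlhd> Y \<Longrightarrow> Y \<unlhd> X \<Longrightarrow> X = Y"
  unfolding below_def using incl_antisym[OF A A] by blast

lemma below_top: "X \<in> Rel R A A \<Longrightarrow> X \<unlhd> \<top> A A"
  using incl_greatest A by (auto simp: below_def)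

lemma below_meet: "Z \<unlhd> X \<Longrightarrow> Z \<unlhd> Y \<Longrightarrow> Z \<unlhd> X \<sqinter> Y"
  unfolding below_def using meet_glb[OF A A] by auto

lemma meet_below:
  assumes "X \<in> Rel R A A" "Y \<in> Rel R A A"
  shows "X \<sqinter> Y \<unlhd> X" "X \<sqinter> Y \<unlhd> Y"
  unfolding below_def using meet_glb[OF A A, of X Y "X \<sqinter> Y"] incl_refl[OF A A] assms by auto

lemma join_below: "X \<unlhd> Z \<Longrightarrow> Y \<unlhd> Z \<Longrightarrow> X \<squnion> Y \<unlhd> Z"
  unfolding below_def using join_lub[OF A A] by auto

lemma below_join:
  assumes "X \<in> Rel R A A" "Y \<in> Rel R A A"
  shows "X \<unlhd> X \<squnion> Y" "Y \<unlhd> X \<squnion> Y"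
  unfolding below_def using join_lub[OF A A, of X Y "X \<squnion> Y"] incl_refl[OF A A] assms by auto

text \<open>Composing with \<open>X\<close> on the left has the upper adjoint
  \<open>under R X\<close>, so bounds on the two composites become one bound on
  \<open>Y \<squnion> Z\<close>. This supplies the distribution of composition over joins;
  \<open>over\<close> does the same on the other side.\<close>

lemma comp_join_below:
  assumes "X \<odot> Y \<unlhd> V" "X \<odot> Z \<unlhd> V" "X \<in> Rel R A A" "Y \<in> Rel R A A" "Z \<in> Rel R A A"
  shows "X \<odot> (Y \<squnion> Z) \<unlhd> V"
proof -
  have "V \<in> Rel R A A" using assms(1) by (rule below_types)
  then have "Y \<squnion> Z \<sqsubseteq> under R X V"
    using assms join_lub[OF A A, of Y Z "under R X V"] under_type[OF A A A, of X V]
      under_galois[OF A A A, of X Y V] under_galois[OF A A A, of X Z V] by (simp add: below_def)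
  with \<open>V \<in> Rel R A A\<close> show ?thesis
    using assms under_galois[OF A A A, of X "Y \<squnion> Z" V] by (simp add: below_def)
qed

lemma join_comp_below:
  assumes "Y \<odot> X \<unlhd> V" "Z \<odot> X \<unlhd> V" "X \<in> Rel R A A" "Y \<in> Rel R A A" "Z \<in> Rel R A A"
  shows "(Y \<squnion> Z) \<odot> X \<unlhd> V"
proof -
  have "V \<in> Rel R A A" using assms(1) by (rule below_types)
  then have "Y \<squnion> Z \<sqsubseteq> over R V X"
    using assms join_lub[OF A A, of Y Z "over R V X"] over_type[OF A A A, of V X]
      over_galois[OF A A A, of Y X V] over_galois[OF A A A, of Z X V] by (simp add: below_def)
  with \<open>V \<in> Rel R A A\<close> show ?thesis
    using assms over_galois[OF A A A, of "Y \<squnion> Z" X V] by (simp add: below_def)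
qed

lemma comp_mono:
  assumes "X \<unlhd> Y" "Z \<unlhd> V"
  shows "X \<odot> Z \<unlhd> Y \<odot> V"
proof -
  note t = below_types[OF assms(1)] below_types[OF assms(2)]
  have "Z \<sqsubseteq> under R X (X \<odot> V)"
    using under_galois[OF A A A, of X V "X \<odot> V"] under_type[OF A A A, of X "X \<odot> V"]
      incl_refl[OF A A, of "X \<odot> V"] incl_trans[OF A A, of Z V] t assms(2)
    by (auto simp: below_def)
  then have "X \<odot> Z \<unlhd> X \<odot> V"
    using under_galois[OF A A A] t by (auto simp: below_def)
  also have "X \<sqsubseteq> over R (Y \<odot> V) V"
    using over_galois[OF A A A, of Y V "Y \<odot> V"] over_type[OF A A A, of "Y \<odot> V" V]
      incl_refl[OF A A, of "Y \<odot> V"] incl_trans[OF A A, of X Y] t assms(1)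
    by (auto simp: below_def)
  then have "X \<odot> V \<unlhd> Y \<odot> V"
    using over_galois[OF A A A] t by (auto simp: below_def)
  finally show ?thesis .
qed

section \<open>Converse and the modular law\<close>

lemma conv_conv [simp]:
  assumes "X \<in> Rel R A A"
  shows "(X\<smile>)\<smile> = X"
proof -
  have "X \<unlhd> (X\<smile>)\<smile>" if "X \<in> Rel R A A" for X
    using converse_galois[OF A A, of X "X\<smile>"] incl_refl[OF A A] that by (auto simp: below_def)
  moreover have "(X\<smile>)\<smile> \<unlhd> X"
    using converse_galois[OF A A, of "X\<smile>" X] incl_refl[OF A A] assms by (auto simp: below_def)
  ultimately show ?thesis
    using assms below_antisym by blast
qed

lemma conv_mono: "X \<unlhd> Y \<Longrightarrow> X\<smile> \<unlhd> Y\<smile>"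
  using converse_galois[OF A A, of X "Y\<smile>"] by (auto simp: below_def)

lemma conv_comp: "X \<in> Rel R A A \<Longrightarrow> Y \<in> Rel R A A \<Longrightarrow> (X \<odot> Y)\<smile> = Y\<smile> \<odot> X\<smile>"
  using converse_comp A by blast

lemma conv_top [simp]: "(\<top> A A)\<smile> = \<top> A A"
  using conv_mono[OF below_top[of "(\<top> A A)\<smile>"]] below_top[of "(\<top> A A)\<smile>"]
  by (auto intro: below_antisym)

lemma conv_join:
  assumes "X \<in> Rel R A A" "Y \<in> Rel R A A"
  shows "(X \<squnion> Y)\<smile> = X\<smile> \<squnion> Y\<smile>"
proof (rule below_antisym)
  have "X \<unlhd> (X\<smile> \<squnion> Y\<smile>)\<smile>" "Y \<unlhd> (X\<smile> \<squnion> Y\<smile>)\<smile>"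
    using conv_mono[OF below_join(1), of "X\<smile>" "Y\<smile>"] conv_mono[OF below_join(2), of "X\<smile>" "Y\<smile>"]
      assms by auto
  then show "(X \<squnion> Y)\<smile> \<unlhd> X\<smile> \<squnion> Y\<smile>"
    using conv_mono[OF join_below] assms by fastforce
  show "X\<smile> \<squnion> Y\<smile> \<unlhd> (X \<squnion> Y)\<smile>"
    using assms by (intro join_below conv_mono below_join)
qed

lemma modular:
  assumes "X \<in> Rel R A A" "Y \<in> Rel R A A" "Z \<in> Rel R A A"
  shows "X \<odot> Y \<sqinter> Z \<unlhd> X \<odot> (Y \<sqinter> X\<smile> \<odot> Z)"
  using modularity[OF A A A] assms by (auto simp: below_def)

section \<open>Coreflexives: relations below the identity\<close>

text \<open>The modular law with the identity as middle factor gives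
  \<open>X \<unlhd> X \<odot> (X\<smile> \<odot> X)\<close>; bounding the outer copies of
  \<open>X\<close> by the identity leaves \<open>X\<smile>\<close>. Applying this to
  \<open>X\<smile>\<close> as well gives equality.\<close>

lemma coreflexive_conv:
  assumes "X \<unlhd> \<one> A"
  shows "X\<smile> = X"
proof -
  have le: "X \<unlhd> X\<smile>" if X: "X \<unlhd> \<one> A" for X
  proof -
    note t [simp] = below_types(1)[OF X]
    have "X \<unlhd> X \<odot> \<one> A \<sqinter> X"
      by (intro below_meet) auto
    also have "\<dots> \<unlhd> X \<odot> (\<one> A \<sqinter> X\<smile> \<odot> X)"
      by (intro modular) auto
    also have "\<dots> \<unlhd> \<one> A \<odot> (X\<smile> \<odot> \<one> A)"
      using X by (intro comp_mono below_trans[OF meet_below(2)]) auto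
    finally show ?thesis by simp
  qed
  have "X\<smile> \<unlhd> \<one> A"
    using conv_mono[OF assms] converse_ident[OF A] by simp
  then have "X\<smile> \<unlhd> X"
    using le[of "X\<smile>"] below_types(1)[OF assms] by simp
  then show ?thesis
    using le[OF assms] by (rule below_antisym)
qed

lemma coreflexive_idem:
  assumes "X \<unlhd> \<one> A"
  shows "X \<odot> X = X"
proof (rule below_antisym)
  note t [simp] = below_types(1)[OF assms]
  show "X \<odot> X \<unlhd> X"
    using comp_mono[OF assms below_refl, of X] by simp
  have "X \<unlhd> X \<odot> \<one> A \<sqinter> X"
    by (intro below_meet) auto
  also have "\<dots> \<unlhd> X \<odot> (\<one> A \<sqinter> X\<smile> \<odot> X)"
    by (intro modular) auto
  also have "\<dots> \<unlhd> X \<odot> (\<one> A \<odot> X)"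
    using assms
    by (intro comp_mono below_trans[OF meet_below(2)]) (auto simp: coreflexive_conv)
  finally show "X \<unlhd> X \<odot> X" by simp
qed

lemma coreflexive_comp_below:
  assumes "X \<unlhd> \<one> A" "Y \<in> Rel R A A"
  shows "X \<odot> Y \<unlhd> Y" "Y \<odot> X \<unlhd> Y"
  using comp_mono[OF assms(1) below_refl] comp_mono[OF below_refl assms(1)] assms by auto

lemma coreflexive_comp: "X \<unlhd> \<one> A \<Longrightarrow> Y \<unlhd> \<one> A \<Longrightarrow> X \<odot> Y \<unlhd> \<one> A"
  using comp_mono[of X "\<one> A" Y "\<one> A"] by simp

text \<open>The product is again coreflexive, hence equal to its own converse, which is the product
  in the other order.\<close>

lemma coreflexive_commute:
  assumes "X \<unlhd> \<one> A" "Y \<unlhd> \<one> A"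
  shows "X \<odot> Y = Y \<odot> X"
proof -
  have "X \<odot> Y = (X \<odot> Y)\<smile>"
    using coreflexive_conv[OF coreflexive_comp[OF assms]] ..
  then show ?thesis
    using conv_comp[of X Y] assms below_types(1) by (simp add: coreflexive_conv)
qed

text \<open>By the modular law the diagonal part of \<open>X \<odot> Y\<close> is at most
  \<open>X \<odot> X\<smile>\<close>, which is \<open>X\<close>. It serves to cut a bound
  \<open>D \<odot> \<top> A A\<close> down to \<open>D\<close>.\<close>

lemma coreflexive_restrict:
  assumes "X \<unlhd> \<one> A" "Y \<in> Rel R A A"
  shows "\<one> A \<sqinter> X \<odot> Y \<unlhd> X"
proof -
  note t [simp] = assms(2) below_types(1)[OF assms(1)]
  have "\<one> A \<sqinter> X \<odot> Y \<unlhd> X \<odot> Y \<sqinter> \<one> A"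
    by (intro below_meet meet_below) auto
  also have "\<dots> \<unlhd> X \<odot> (Y \<sqinter> X\<smile> \<odot> \<one> A)"
    by (intro modular) auto
  also have "\<dots> \<unlhd> X \<odot> X"
    using assms(1)
    by (intro comp_mono below_trans[OF meet_below(2)]) (auto simp: coreflexive_conv)
  finally show ?thesis
    using assms(1) by (simp add: coreflexive_idem)
qed

section \<open>Pers and their domains\<close>

lemma per_type: "is_per R A P \<Longrightarrow> P \<in> Rel R A A"
  by (simp add: is_per_def)

lemma is_per_iff: "is_per R A P \<longleftrightarrow> P \<in> Rel R A A \<and> P\<smile> = P \<and> P \<odot> P \<unlhd> P"
  using A by (auto simp: is_per_def below_def)

lemma per_dom_below:
  assumes "is_per R A P"
  shows "per_dom R A P \<unlhd> \<one> A" "per_dom R A P \<unlhd> P"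
  unfolding per_dom_def using meet_below per_type[OF assms] by auto

text \<open>The modular law bounds \<open>P\<close> by
  \<open>P \<odot> (\<one> A \<sqinter> P\<smile> \<odot> P)\<close>, and symmetry with transitivity
  puts \<open>P\<smile> \<odot> P\<close> below \<open>P\<close>. The left law is the converse of
  the right one.\<close>

lemma per_dom_comp:
  assumes P: "is_per R A P"
  shows "P \<odot> per_dom R A P = P" "per_dom R A P \<odot> P = P"
proof -
  note t [simp] = per_type[OF P] per_dom_below(1)[OF P, THEN below_types(1)]
  have sym: "P\<smile> = P" and tr: "P \<odot> P \<unlhd> P"
    using P by (auto simp: is_per_iff)
  have "P \<unlhd> P \<odot> \<one> A \<sqinter> P"
    by (intro below_meet) auto
  also have "\<dots> \<unlhd> P \<odot> (\<one> A \<sqinter> P\<smile> \<odot> P)"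
    by (intro modular) auto
  also have "\<dots> \<unlhd> P \<odot> per_dom R A P"
    unfolding per_dom_def sym using tr
    by (intro comp_mono below_meet meet_below below_trans[OF meet_below(2)]) auto
  finally show right: "P \<odot> per_dom R A P = P"
    using coreflexive_comp_below(2)[OF per_dom_below(1)[OF P]] by (intro below_antisym) auto
  have "per_dom R A P \<odot> P = (P \<odot> per_dom R A P)\<smile>"
    using coreflexive_conv[OF per_dom_below(1)[OF P]] by (simp add: conv_comp sym)
  then show "per_dom R A P \<odot> P = P"
    using right sym by simp
qed

section \<open>The inclusion implies maximality\<close>

lemma support_below_imp_maximal:
  assumes P: "is_per R A P" and E: "\<one> A \<sqinter> \<top> A A \<odot> P \<odot> \<top> A A \<unlhd> P"
  shows "maximal_per R A P"
  unfolding maximal_per_def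
proof (intro conjI allI impI P)
  fix Q assume Q: "is_per R A Q" and th: "thins R A P Q"
  let ?D = "per_dom R A P" and ?F = "per_dom R A Q"
  note t [simp] = per_type[OF P] per_type[OF Q] per_dom_below(1)[OF P, THEN below_types(1)]
    per_dom_below(1)[OF Q, THEN below_types(1)]
  have PQ: "P = ?D \<odot> Q \<odot> ?D" and QQ: "Q = Q \<odot> ?D \<odot> Q"
    using th by (auto simp: thins_def)
  have "?F \<unlhd> Q \<odot> ?D \<odot> Q"
    using per_dom_below(2)[OF Q] QQ by simp
  also have "\<dots> \<unlhd> \<top> A A \<odot> P \<odot> \<top> A A"
    using per_dom_below(2)[OF P] by (intro comp_mono below_top) auto
  finally have "?F \<unlhd> \<one> A \<sqinter> \<top> A A \<odot> P \<odot> \<top> A A"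
    using per_dom_below(1)[OF Q] by (intro below_meet)
  also note E
  finally have F: "?F \<unlhd> ?D"
    unfolding per_dom_def[of R A P] using per_dom_below(1)[OF Q] by (intro below_meet)
  show "P = Q"
  proof (rule below_antisym)
    have "?D \<odot> Q \<odot> ?D \<unlhd> \<one> A \<odot> Q \<odot> \<one> A"
      using per_dom_below(1)[OF P] by (intro comp_mono) auto
    then show "P \<unlhd> Q"
      using PQ by simp
    \<comment> \<open>The left side is \<open>Q\<close> itself, and enlarging \<open>?F\<close> to
      \<open>?D\<close> yields the expression that thinning gives for \<open>P\<close>.\<close>
    have "?F \<odot> Q \<odot> ?F \<unlhd> ?D \<odot> Q \<odot> ?D"
      using F by (intro comp_mono) auto
    then show "Q \<unlhd> P"
      using PQ by (simp add: per_dom_comp[OF Q])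
  qed
qed

section \<open>Choosing a point of a coreflexive\<close>

text \<open>\<open>D \<odot> \<top> A A \<odot> D\<close> relates any two points of
  \<open>D\<close>; it is transitive because \<open>\<top> A A\<close> absorbs whatever stands
  between the outer factors. Adding the identity leaves every point outside \<open>D\<close> in a
  class of its own.\<close>

lemma collapse_per:
  assumes D: "D \<unlhd> \<one> A"
  shows "is_per R A (\<one> A \<squnion> D \<odot> \<top> A A \<odot> D)"
proof -
  let ?S = "D \<odot> \<top> A A \<odot> D"
  note t [simp] = below_types(1)[OF D]
  have "?S\<smile> = ?S"
    using D by (simp add: conv_comp coreflexive_conv assoc)
  then have "(\<one> A \<squnion> ?S)\<smile> = \<one> A \<squnion> ?S"
    using converse_ident[OF A] by (simp add: conv_join)
  moreover have "?S \<odot> ?S \<unlhd> ?S"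
  proof -
    have "?S \<odot> ?S = D \<odot> (\<top> A A \<odot> D \<odot> D \<odot> \<top> A A) \<odot> D"
      by (simp add: assoc)
    also have "\<dots> \<unlhd> ?S"
      by (intro comp_mono below_top below_refl) auto
    finally show ?thesis .
  qed
  then have "?S \<odot> ?S \<unlhd> \<one> A \<squnion> ?S"
    by (rule below_trans) (auto intro: below_join)
  then have "(\<one> A \<squnion> ?S) \<odot> (\<one> A \<squnion> ?S) \<unlhd> \<one> A \<squnion> ?S"
    by (intro join_comp_below comp_join_below) (auto intro: below_join)
  ultimately show ?thesis
    by (simp add: is_per_iff)
qed

text \<open>An index keeps one point of each class. Singleton classes survive whole, so
  \<open>J\<close> and \<open>D\<close> cover the identity, while \<open>J \<odot> D\<close>
  represents the single class \<open>D\<close>. That it is non-empty wherever \<open>D\<close> is,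
  and has at most one point, is expressed by the last two properties without the cone rule.\<close>

lemma choice_splits:
  assumes D: "D \<unlhd> \<one> A" and ac: "axiom_of_choice R"
  obtains J where "J \<unlhd> \<one> A" "\<one> A \<unlhd> J \<squnion> D" "D \<unlhd> \<top> A A \<odot> (J \<odot> D) \<odot> \<top> A A"
    "J \<odot> D \<odot> \<top> A A \<odot> (J \<odot> D) \<unlhd> J \<odot> D"
proof -
  let ?T = "\<top> A A"
  let ?S = "D \<odot> ?T \<odot> D"
  let ?W = "\<one> A \<squnion> ?S"
  have W: "is_per R A ?W"
    using collapse_per[OF D] .
  then obtain J where J: "is_index R A ?W J"
    using ac by (auto simp: axiom_of_choice_def)
  note t [simp] = below_types(1)[OF D]
  have tJ [simp]: "J \<in> Rel R A A"
    using J by (simp add: is_index_def)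
  have "J \<unlhd> per_dom R A ?W"
    using J per_dom_below(1)[OF W, THEN below_types(1)] by (simp add: is_index_def below_def)
  then have JI: "J \<unlhd> \<one> A"
    using per_dom_below(1)[OF W] by (rule below_trans)
  have JWJ: "J \<odot> ?W \<odot> J = J" and WJW: "?W \<odot> J \<odot> ?W = ?W"
    using J by (auto simp: is_index_def)
  have comm: "D \<odot> J = J \<odot> D"
    using coreflexive_commute[OF D JI] .
  let ?K = "J \<odot> D"
  \<comment> \<open>Expanding both outer factors in \<open>?W = ?W \<odot> J \<odot> ?W\<close>
    leaves the four products listed as premises. Two choices of \<open>V\<close> are used
    below.\<close>
  have W_below: "?W \<unlhd> V"
    if J1: "J \<unlhd> V" and J2: "J \<odot> ?S \<unlhd> V" and J3: "?S \<odot> J \<unlhd> V" and J4: "?S \<odot> J \<odot> ?S \<unlhd> V" for V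
  proof -
    have a: "\<one> A \<odot> J \<odot> ?W \<unlhd> V" using J1 J2 by (auto intro: comp_join_below)
    have b: "?S \<odot> J \<odot> ?W \<unlhd> V" using J3 J4 by (intro comp_join_below) auto
    have "?W \<odot> (J \<odot> ?W) \<unlhd> V" using a b by (intro join_comp_below) (auto simp: assoc)
    then show ?thesis using WJW by (simp add: assoc)
  qed
  have "?W \<unlhd> J \<squnion> D \<odot> ?T"
  proof (rule W_below)
    show "J \<unlhd> J \<squnion> D \<odot> ?T" by (auto intro: below_join)
    \<comment> \<open>Each of the three products containing \<open>?S\<close> can be written with
      \<open>D\<close> as leftmost factor, since \<open>D\<close> and \<open>J\<close>
      commute.\<close>
    have DX: "D \<odot> X \<unlhd> J \<squnion> D \<odot> ?T" if "X \<in> Rel R A A" for X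
      using that
      by (intro below_trans[OF comp_mono[OF below_refl below_top] below_join(2)]) auto
    have "J \<odot> ?S = D \<odot> (J \<odot> (?T \<odot> D))"
      using comm by (simp add: assoc[symmetric])
    then show "J \<odot> ?S \<unlhd> J \<squnion> D \<odot> ?T" using DX by simp
    show "?S \<odot> J \<unlhd> J \<squnion> D \<odot> ?T" "?S \<odot> J \<odot> ?S \<unlhd> J \<squnion> D \<odot> ?T"
      using DX by (simp_all add: assoc)
  qed
  then have "\<one> A \<unlhd> J \<squnion> D \<odot> ?T"
    using below_trans[OF below_join(1)[of "\<one> A" ?S]] by simp
  \<comment> \<open>Lattice distributivity isolates the diagonal part of
    \<open>D \<odot> ?T\<close>, which \<open>coreflexive_restrict\<close> bounds by
    \<open>D\<close>.\<close>
  then have "\<one> A \<unlhd> \<one> A \<sqinter> (J \<squnion> D \<odot> ?T)"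
    by (intro below_meet) auto
  also have "\<dots> = (\<one> A \<sqinter> J) \<squnion> (\<one> A \<sqinter> D \<odot> ?T)"
    using meet_join_distrib[OF A A] by simp
  also have "\<dots> \<unlhd> J \<squnion> D"
    by (intro join_below below_trans[OF meet_below(2) below_join(1)]
        below_trans[OF coreflexive_restrict[OF D] below_join(2)]) auto
  finally have split: "\<one> A \<unlhd> J \<squnion> D" .
  \<comment> \<open>For the second bound, each product containing \<open>?S\<close> passes through
    \<open>?K\<close>, because a factor \<open>D\<close> of \<open>?S\<close> meets
    \<open>J\<close>.\<close>
  have XKY: "X \<odot> ?K \<odot> Y \<unlhd> ?T \<odot> ?K \<odot> ?T" if "X \<in> Rel R A A" "Y \<in> Rel R A A" for X Y
    using that by (intro comp_mono below_top) auto
  have "?W \<unlhd> J \<squnion> ?T \<odot> ?K \<odot> ?T"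
  proof (rule W_below)
    note right = below_trans[OF _ below_join(2)[of J "?T \<odot> ?K \<odot> ?T"]]
    show "J \<unlhd> J \<squnion> ?T \<odot> ?K \<odot> ?T" by (auto intro: below_join)
    have "J \<odot> ?S = \<one> A \<odot> ?K \<odot> (?T \<odot> D)"
      by (simp add: assoc)
    then have "J \<odot> ?S \<unlhd> ?T \<odot> ?K \<odot> ?T" using XKY[of "\<one> A" "?T \<odot> D"] by simp
    then show "J \<odot> ?S \<unlhd> J \<squnion> ?T \<odot> ?K \<odot> ?T" by (rule right) auto
    have SJ: "?S \<odot> J = D \<odot> ?T \<odot> ?K"
      using comm by (simp add: assoc)
    then have "?S \<odot> J \<unlhd> ?T \<odot> ?K \<odot> ?T" using XKY[of "D \<odot> ?T" "\<one> A"] by simp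
    then show "?S \<odot> J \<unlhd> J \<squnion> ?T \<odot> ?K \<odot> ?T" by (rule right) auto
    have "?S \<odot> J \<odot> ?S \<unlhd> ?T \<odot> ?K \<odot> ?T" using SJ XKY[of "D \<odot> ?T" ?S] by simp
    then show "?S \<odot> J \<odot> ?S \<unlhd> J \<squnion> ?T \<odot> ?K \<odot> ?T" by (rule right) auto
  qed
  then have "\<one> A \<unlhd> J \<squnion> ?T \<odot> ?K \<odot> ?T"
    using below_trans[OF below_join(1)[of "\<one> A" ?S]] by simp
  \<comment> \<open>Restricting to \<open>D\<close> turns the summand \<open>J\<close> into
    \<open>?K\<close>, which is below \<open>?T \<odot> ?K \<odot> ?T\<close> as well.\<close>
  then have "D \<odot> \<one> A \<unlhd> D \<odot> (J \<squnion> ?T \<odot> ?K \<odot> ?T)"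
    by (intro comp_mono) auto
  also have "\<dots> \<unlhd> ?T \<odot> ?K \<odot> ?T"
  proof (rule comp_join_below)
    have "?K \<unlhd> ?T \<odot> ?K \<odot> ?T"
      using comp_mono[OF comp_mono[OF below_top below_refl] below_top, of "\<one> A" ?K "\<one> A"] by simp
    then show "D \<odot> J \<unlhd> ?T \<odot> ?K \<odot> ?T" using comm by simp
    show "D \<odot> (?T \<odot> ?K \<odot> ?T) \<unlhd> ?T \<odot> ?K \<odot> ?T"
      using D by (intro coreflexive_comp_below) auto
  qed auto
  finally have supp: "D \<unlhd> ?T \<odot> ?K \<odot> ?T" by simp
  \<comment> \<open>Rewriting the second \<open>?K\<close> as \<open>D \<odot> J \<odot> D\<close>
    exposes \<open>?S\<close> between two copies of \<open>J\<close>; as \<open>?S\<close> is part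
    of \<open>?W\<close>, \<open>JWJ\<close> then reduces the product to \<open>?K\<close>.\<close>
  have "?K \<odot> ?T \<odot> ?K = J \<odot> ?S \<odot> J \<odot> D"
  proof -
    have "?K = D \<odot> J \<odot> D" using comm coreflexive_idem[OF D] by (simp add: assoc)
    then show ?thesis by (simp add: assoc)
  qed
  also have "\<dots> \<unlhd> J \<odot> ?W \<odot> J \<odot> D"
    by (intro comp_mono below_join below_refl) auto
  finally have point: "?K \<odot> ?T \<odot> ?K \<unlhd> ?K"
    using JWJ by simp
  show thesis
    using that[OF JI split supp point] .
qed

section \<open>Maximality implies the inclusion\<close>

lemma maximal_imp_support_below:
  assumes ac: "axiom_of_choice R" and max: "maximal_per R A P"
  shows "\<one> A \<sqinter> \<top> A A \<odot> P \<odot> \<top> A A \<unlhd> P"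
proof -
  let ?T = "\<top> A A"
  have P: "is_per R A P"
    using max by (simp add: maximal_per_def)
  have sym: "P\<smile> = P" and tr: "P \<odot> P \<unlhd> P"
    using P by (auto simp: is_per_iff)
  define D where "D = per_dom R A P"
  have D: "D \<unlhd> \<one> A" and DP: "D \<unlhd> P" and PD: "P \<odot> D = P" "D \<odot> P = P"
    using per_dom_below[OF P] per_dom_comp[OF P] by (auto simp: D_def)
  obtain J where J: "J \<unlhd> \<one> A" and split: "\<one> A \<unlhd> J \<squnion> D"
    and supp: "D \<unlhd> ?T \<odot> (J \<odot> D) \<odot> ?T" and point: "J \<odot> D \<odot> ?T \<odot> (J \<odot> D) \<unlhd> J \<odot> D"
    using choice_splits[OF D ac] .
  define K where "K = J \<odot> D"
  note t [simp] = per_type[OF P] below_types(1)[OF D] below_types(1)[OF J]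
  have tK [simp]: "K \<in> Rel R A A" by (simp add: K_def)
  have K: "K \<unlhd> \<one> A"
    using coreflexive_comp[OF J D] by (simp add: K_def)
  have KD: "K \<unlhd> D"
    using coreflexive_comp_below(1)[OF J] by (simp add: K_def)
  define B where "B = D \<squnion> J \<odot> ?T \<odot> K"
  have tB [simp]: "B \<in> Rel R A A" by (simp add: B_def)
  \<comment> \<open>The two summands of \<open>B\<close> overlap on \<open>K\<close>. They agree
    there because \<open>K\<close> has at most one point, which makes \<open>B\<close> the identity
    on \<open>D\<close>.\<close>
  have "D \<odot> (J \<odot> ?T \<odot> K) = K \<odot> ?T \<odot> K"
    using coreflexive_commute[OF D J] by (simp add: K_def assoc[symmetric])
  also have "\<dots> \<unlhd> D"
    using point KD by (auto simp: K_def[symmetric] intro: below_trans)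
  finally have "D \<odot> B \<unlhd> D"
    unfolding B_def using coreflexive_idem[OF D] by (intro comp_join_below) auto
  moreover have "D \<odot> D \<unlhd> D \<odot> B"
    unfolding B_def by (intro comp_mono below_join below_refl) auto
  ultimately have DB: "D \<odot> B = D"
    using coreflexive_idem[OF D] below_antisym by simp
  then have BD: "B\<smile> \<odot> D = D"
    using conv_comp[of D B] coreflexive_conv[OF D] by simp
  \<comment> \<open>This is the product of the second summands in
    \<open>B\<smile> \<odot> B\<close>; the mixed products reduce to \<open>D\<close> or to
    \<open>K \<odot> ?T \<odot> K\<close> as well.\<close>
  have "K \<odot> ?T \<odot> J \<odot> (J \<odot> ?T \<odot> K) \<unlhd> K \<odot> ?T \<odot> K"
  proof -
    have "K \<odot> ?T \<odot> J \<odot> (J \<odot> ?T \<odot> K) = K \<odot> (?T \<odot> J \<odot> J \<odot> ?T) \<odot> K"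
      by (simp add: assoc)
    also have "\<dots> \<unlhd> K \<odot> ?T \<odot> K"
      by (intro comp_mono below_top below_refl) auto
    finally show ?thesis .
  qed
  also have KTK: "K \<odot> ?T \<odot> K \<unlhd> D"
    using point KD by (auto simp: K_def[symmetric] intro: below_trans)
  finally have KK: "K \<odot> ?T \<odot> J \<odot> (J \<odot> ?T \<odot> K) \<unlhd> D" .
  have convB: "B\<smile> = D \<squnion> K \<odot> ?T \<odot> J"
    using coreflexive_conv[OF D] coreflexive_conv[OF J] coreflexive_conv[OF K]
    by (simp add: B_def conv_join conv_comp assoc)
  have "K \<odot> ?T \<odot> J \<odot> D \<unlhd> D"
    using KTK by (simp add: K_def assoc)
  then have "K \<odot> ?T \<odot> J \<odot> B \<unlhd> D"
    unfolding B_def using KK by (intro comp_join_below) auto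
  then have simple: "B\<smile> \<odot> B \<unlhd> D"
    unfolding convB using DB below_refl[of D] by (intro join_comp_below) auto
  define Q where "Q = B \<odot> P \<odot> B\<smile>"
  have tQ [simp]: "Q \<in> Rel R A A" by (simp add: Q_def)
  \<comment> \<open>The inner \<open>B\<smile> \<odot> B\<close> is at most \<open>D\<close> by
    \<open>simple\<close>, and \<open>P\<close> absorbs \<open>D\<close>; transitivity of
    \<open>Q\<close> thus reduces to that of \<open>P\<close>.\<close>
  have "Q \<odot> Q = B \<odot> P \<odot> (B\<smile> \<odot> B) \<odot> P \<odot> B\<smile>"
    by (simp add: Q_def assoc)
  also have "\<dots> \<unlhd> B \<odot> P \<odot> D \<odot> P \<odot> B\<smile>"
    using simple by (intro comp_mono) auto
  also have "\<dots> = B \<odot> (P \<odot> P) \<odot> B\<smile>"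
    using PD by (simp add: assoc)
  also have "\<dots> \<unlhd> Q"
    unfolding Q_def using tr by (intro comp_mono) auto
  finally have Q: "is_per R A Q"
    using sym by (simp add: is_per_iff Q_def conv_comp assoc)
  have "D \<odot> Q \<odot> D = (D \<odot> B) \<odot> P \<odot> (B\<smile> \<odot> D)"
    by (simp add: Q_def assoc)
  then have 1: "D \<odot> Q \<odot> D = P"
    using DB BD PD by simp
  have "Q \<odot> D \<odot> Q = B \<odot> P \<odot> (B\<smile> \<odot> D) \<odot> B \<odot> P \<odot> B\<smile>"
    by (simp add: Q_def assoc)
  also have "\<dots> = B \<odot> (P \<odot> ((D \<odot> B) \<odot> P)) \<odot> B\<smile>"
    by (simp add: BD assoc)
  also have "\<dots> = B \<odot> (P \<odot> P) \<odot> B\<smile>"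
    using DB PD by simp
  also have "P \<odot> P = P"
    using tr comp_mono[OF DP below_refl, of P] PD by (auto intro: below_antisym)
  finally have "Q \<odot> D \<odot> Q = Q" by (simp add: Q_def)
  with 1 have "thins R A P Q"
    using P Q by (simp add: thins_def D_def)
  then have PQ: "P = Q"
    using max Q by (auto simp: maximal_per_def)
  let ?E = "\<one> A \<sqinter> ?T \<odot> P \<odot> ?T"
  have E: "?E \<unlhd> \<one> A"
    by (intro meet_below) auto
  note tE [simp] = below_types(1)[OF E]
  have KQ: "J \<odot> ?T \<odot> K \<odot> ?T \<odot> J \<unlhd> Q"
  proof -
    \<comment> \<open>\<open>K\<close> is tripled so that its copies can end the part of
      \<open>B\<close> leaving \<open>J\<close>, lie inside \<open>P\<close>, and start the
      corresponding part of \<open>B\<smile>\<close>.\<close>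
    have "J \<odot> ?T \<odot> K \<odot> ?T \<odot> J = J \<odot> ?T \<odot> (K \<odot> K \<odot> K) \<odot> ?T \<odot> J"
      using coreflexive_idem[OF K] by simp
    also have "\<dots> = (J \<odot> ?T \<odot> K) \<odot> K \<odot> (K \<odot> ?T \<odot> J)"
      by (simp add: assoc)
    also have "\<dots> \<unlhd> B \<odot> P \<odot> B\<smile>"
    proof (intro comp_mono)
      show "J \<odot> ?T \<odot> K \<unlhd> B" unfolding B_def by (intro below_join) auto
      show "K \<odot> ?T \<odot> J \<unlhd> B\<smile>" unfolding convB by (intro below_join) auto
      show "K \<unlhd> P" using KD DP by (rule below_trans)
    qed
    finally show ?thesis unfolding Q_def .
  qed
  \<comment> \<open>A factor \<open>D\<close> is split off \<open>P\<close> so that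
    \<open>supp\<close> can replace it: the support of \<open>P\<close> is already that of the
    single point \<open>K\<close>.\<close>
  have "?T \<odot> P \<odot> ?T = ?T \<odot> D \<odot> (P \<odot> ?T)"
    using PD(2) by (simp add: assoc[symmetric]) (simp add: assoc)
  also have "\<dots> \<unlhd> ?T \<odot> (?T \<odot> K \<odot> ?T) \<odot> (P \<odot> ?T)"
    using supp unfolding K_def by (intro comp_mono) auto
  also have "\<dots> = (?T \<odot> ?T) \<odot> K \<odot> (?T \<odot> P \<odot> ?T)"
    by (simp add: assoc)
  also have "\<dots> \<unlhd> ?T \<odot> K \<odot> ?T"
    by (intro comp_mono below_top below_refl) auto
  finally have "?E \<unlhd> ?T \<odot> K \<odot> ?T"
    using below_trans[OF meet_below(2)] by simp
  then have "J \<odot> ?E \<odot> J \<unlhd> J \<odot> (?T \<odot> K \<odot> ?T) \<odot> J"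
    by (intro comp_mono) auto
  also have "J \<odot> ?E \<odot> J = J \<odot> ?E"
    using coreflexive_commute[OF E J] coreflexive_idem[OF J] by (simp add: assoc) (simp add: assoc[symmetric])
  finally have JE: "J \<odot> ?E \<unlhd> P"
    using KQ PQ by (auto simp: assoc intro: below_trans)
  \<comment> \<open>By \<open>split\<close>, \<open>?E\<close> is covered by its restrictions to
    \<open>J\<close> and to \<open>D\<close>. The first lies in \<open>P\<close> by
    \<open>PQ\<close>, the second because \<open>D\<close> does.\<close>
  have "D \<odot> ?E \<unlhd> P"
    using coreflexive_comp_below(2)[OF E, of D] DP by (auto intro: below_trans)
  with JE have "(J \<squnion> D) \<odot> ?E \<unlhd> P"
    by (intro join_comp_below) auto
  then show ?thesis
    using comp_mono[OF split below_refl, of ?E] by (auto intro: below_trans)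
qed

end

end

theorem theorem52:
  fixes R :: "('t, 'r, 'm) relation_algebra_scheme"
    and A :: 't and P :: 'r
  assumes "point_free_relation_algebra R"
    and "axiom_of_choice R"
    and "is_per R A P"
  shows "maximal_per R A P \<longleftrightarrow>
    \<one>\<^bsub>R\<^esub> A \<sqinter>\<^bsub>R\<^esub> \<top>\<^bsub>R\<^esub> A A \<odot>\<^bsub>R\<^esub> P \<odot>\<^bsub>R\<^esub> \<top>\<^bsub>R\<^esub> A A \<sqsubseteq>\<^bsub>R\<^esub> P"
proof -
  interpret point_free_relation_algebra R by fact
  have A: "A \<in> basic_types R" and P: "P \<in> Rel R A A"
    using assms(3) by (auto simp: is_per_def)
  \<comment> \<open>The order \<open>below\<close> also asserts typing, so passing from the plain
    inclusion to it requires the type of the left side.\<close>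
  have "\<one>\<^bsub>R\<^esub> A \<sqinter>\<^bsub>R\<^esub> \<top>\<^bsub>R\<^esub> A A \<odot>\<^bsub>R\<^esub> P \<odot>\<^bsub>R\<^esub> \<top>\<^bsub>R\<^esub> A A \<in> Rel R A A"
    using types[OF A] P by simp
  with P show ?thesis
    using maximal_imp_support_below[OF A assms(2)] support_below_imp_maximal[OF A assms(3)]
    by (auto simp: below_def[OF A])
qed

end
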